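(* Let $n,m$ be positive integers, and let $\mathcal{S}_{n,m}$ be the set of all $n\times m$ doubly stochastic arrays. Then the minimal size of the support of an array $A\in\mathcal{S}_{n,m}$ is equal to $n+m-\gcd(n,m)$; that is, $$\min_{A\in\mathcal{S}_{n,m}}|\operatorname{supp}A| = n+m-\gcd(n,m).$$
   Context: An $n\times m$ real matrix $A=(a_{ij})$ is called a doubly stochastic array (with uniform marginals) if $a_{ij}\geq 0$ for all $i,j$, $\sum_{j=1}^m a_{ij}=m$ for every $1\leq i\leq n$, and $\sum_{i=1}^n a_{ij}=n$ for every $1\leq j\leq m$. The set of all such arrays is denoted $\mathcal{S}_{n,m}$. The support of a matrix $A=(a_{ij})$ is $\operatorname{supp}A=\{(i,j): a_{ij}\neq 0\}$, and $|\operatorname{supp}A|$ denotes its cardinality. *)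

theory Defs
  imports Complex_Main "Jordan_Normal_Form.Matrix"
begin

text \<open>The marginals are uniform but not normalised to 1, so that row sums and column sums both
  give the total mass n * m.\<close>

definition doubly_stochastic_arrays :: "nat \<Rightarrow> nat \<Rightarrow> real mat set" where
  "doubly_stochastic_arrays n m =
     {A \<in> carrier_mat n m.
        (\<forall>i<n. \<forall>j<m. A $$ (i, j) \<ge> 0) \<and>
        (\<forall>i<n. (\<Sum>j<m. A $$ (i, j)) = real m) \<and>
        (\<forall>j<m. (\<Sum>i<n. A $$ (i, j)) = real n)}"

definition mat_supp :: "real mat \<Rightarrow> (nat \<times> nat) set" where
  "mat_supp A = {(i, j). i < dim_row A \<and> j < dim_col A \<and> A $$ (i, j) \<noteq> 0}"

text \<open>The support sizes of doubly stochastic arrays form a finite nonempty set, so that taking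
  its \<^const>\<open>Min\<close> is meaningful.\<close>

lemma finite_mat_supp: "finite (mat_supp A)"
  by (rule finite_subset[of _ "{..<dim_row A} \<times> {..<dim_col A}"]) (auto simp: mat_supp_def)

lemma finite_supp_sizes: "finite ((\<lambda>A. card (mat_supp A)) ` doubly_stochastic_arrays n m)"
proof (rule finite_subset)
  show "(\<lambda>A. card (mat_supp A)) ` doubly_stochastic_arrays n m \<subseteq> {..n * m}"
  proof clarsimp
    fix A assume "A \<in> doubly_stochastic_arrays n m"
    then have "mat_supp A \<subseteq> {..<n} \<times> {..<m}"
      by (auto simp: mat_supp_def doubly_stochastic_arrays_def)
    then have "card (mat_supp A) \<le> card ({..<n} \<times> {..<m})"
      by (intro card_mono) auto
    then show "card (mat_supp A) \<le> n * m" by (simp add: card_cartesian_product)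
  qed
qed simp

lemma doubly_stochastic_arrays_nonempty: "doubly_stochastic_arrays n m \<noteq> {}"
proof -
  have "mat n m (\<lambda>_. 1) \<in> doubly_stochastic_arrays n m"
    by (auto simp: doubly_stochastic_arrays_def)
  then show ?thesis by blast
qed

end

theory Submission
  imports Defs
begin

text \<open>View the support of an array as the edge set of a bipartite graph whose vertices are the
  \<open>n\<close> rows and the \<open>m\<close> columns.

  Lower bound: a graph with \<open>v\<close> vertices and \<open>e\<close> edges has at least \<open>v - e\<close> connected
  components. If a component has \<open>r\<close> rows and \<open>c\<close> columns, then all the mass of these rows lies in
  these columns and conversely, so \<open>r * m = c * n\<close>. Hence \<open>n div gcd n m\<close> divides \<open>r\<close>, and \<open>r > 0\<close>
  because a component is nonempty. As the \<open>n\<close> rows are shared between the components, there are at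
  most \<open>gcd n m\<close> of them, and \<open>n + m - e \<le> gcd n m\<close>. Connectivity itself never has to be formalised:
  it suffices to have a labelling of the vertices that is constant along edges and has at least
  \<open>v - e\<close> values (\<open>edge_constant_labelling\<close>), and its fibres take the place of the components
  (\<open>labels_le_gcd\<close>).

  Upper bound: cut the interval \<open>{..<n * m}\<close> of unit masses into \<open>n\<close> blocks of length \<open>m\<close>, one for
  each row, and also into \<open>m\<close> blocks of length \<open>n\<close>, one for each column. The entry \<open>(i, j)\<close> of the
  array is the overlap of the \<open>i\<close>-th row block with the \<open>j\<close>-th column block. A new pair of
  overlapping blocks begins only at a multiple of \<open>m\<close> or of \<open>n\<close>, and inclusion-exclusion
  counts \<open>n + m - gcd n m\<close> such points.\<close>

section \<open>Lower bound: components of the support graph\<close>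

text \<open>Adding an edge requires merging at most two labels, which costs at most one value.\<close>

lemma edge_constant_labelling:
  fixes V :: "'a set"
  assumes "finite V" and "finite E"
  shows "\<exists>f :: 'a \<Rightarrow> 'a. (\<forall>(u, v)\<in>E. f u = f v) \<and> card V \<le> card (f ` V) + card E"
  using assms(2)
proof (induction rule: finite_induct)
  case empty
  show ?case by (intro exI[of _ id]) simp
next
  case (insert e E)
  obtain u v where e: "e = (u, v)" by (cases e)
  from insert.IH obtain f :: "'a \<Rightarrow> 'a"
    where f: "\<forall>(u, v)\<in>E. f u = f v" and card_f: "card V \<le> card (f ` V) + card E"
    by blast
  define f' where "f' = (\<lambda>w. if f w = f u then f v else f w)"
  have "f ` V \<subseteq> insert (f u) (f' ` V)"
    by (auto simp: f'_def)
  then have "card (f ` V) \<le> card (insert (f u) (f' ` V))"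
    using assms(1) by (intro card_mono) auto
  also have "\<dots> \<le> Suc (card (f' ` V))"
    by (rule card_insert_le_m1) auto
  finally have "card V \<le> card (f' ` V) + card (insert e E)"
    using card_f insert.hyps by simp
  moreover have "\<forall>(x, y)\<in>insert e E. f' x = f' y"
    using f by (auto simp: e f'_def)
  ultimately show ?case by blast
qed

text \<open>Both sides are the mass of the block \<open>R \<times> C\<close>, outside of which the rows in \<open>R\<close> and
  the columns in \<open>C\<close> vanish.\<close>

lemma closed_block_balance:
  assumes A: "A \<in> doubly_stochastic_arrays n m"
    and R: "R \<subseteq> {..<n}" and C: "C \<subseteq> {..<m}"
    and closed: "\<And>i j. (i, j) \<in> mat_supp A \<Longrightarrow> i \<in> R \<longleftrightarrow> j \<in> C"
  shows "card R * m = card C * n"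
proof -
  have dim: "dim_row A = n" "dim_col A = m"
    and row: "\<And>i. i < n \<Longrightarrow> (\<Sum>j<m. A $$ (i, j)) = real m"
    and col: "\<And>j. j < m \<Longrightarrow> (\<Sum>i<n. A $$ (i, j)) = real n"
    using A by (auto simp: doubly_stochastic_arrays_def)
  have zero: "A $$ (i, j) = 0" if "i < n" "j < m" "(i \<in> R) \<noteq> (j \<in> C)" for i j
    using closed[of i j] that by (auto simp: mat_supp_def dim)
  have "real (card R * m) = (\<Sum>i\<in>R. \<Sum>j<m. A $$ (i, j))"
    using R by (subst sum.cong[OF refl row]) auto
  also have "\<dots> = (\<Sum>i\<in>R. \<Sum>j\<in>C. A $$ (i, j))"
    using R C zero by (intro sum.cong refl sum.mono_neutral_right) auto
  also have "\<dots> = (\<Sum>j\<in>C. \<Sum>i\<in>R. A $$ (i, j))"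
    by (rule sum.swap)
  also have "\<dots> = (\<Sum>j\<in>C. \<Sum>i<n. A $$ (i, j))"
    using R C zero by (intro sum.cong refl sum.mono_neutral_left) auto
  also have "\<dots> = real (card C * n)"
    using C by (subst sum.cong[OF refl col]) auto
  finally show ?thesis by (simp only: of_nat_eq_iff)
qed

text \<open>Each label class is a closed block, so it takes up a positive multiple of
  \<open>n div gcd n m\<close> rows.\<close>

lemma labels_le_gcd:
  fixes rl cl :: "nat \<Rightarrow> 'l"
  assumes n: "n > 0" and A: "A \<in> doubly_stochastic_arrays n m"
    and const: "\<And>i j. (i, j) \<in> mat_supp A \<Longrightarrow> rl i = cl j"
  shows "card (rl ` {..<n} \<union> cl ` {..<m}) \<le> gcd n m"
proof -
  define L where "L = rl ` {..<n} \<union> cl ` {..<m}"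
  have fibre: "n div gcd n m \<le> card {i \<in> {..<n}. rl i = l}" if "l \<in> L" for l
  proof -
    define R where "R = {i \<in> {..<n}. rl i = l}"
    define C where "C = {j \<in> {..<m}. cl j = l}"
    have "\<And>i j. (i, j) \<in> mat_supp A \<Longrightarrow> i \<in> R \<longleftrightarrow> j \<in> C"
      using const A by (auto simp: R_def C_def mat_supp_def doubly_stochastic_arrays_def)
    then have bal: "card R * m = card C * n"
      by (intro closed_block_balance[OF A]) (auto simp: R_def C_def)
    have "R \<noteq> {} \<or> C \<noteq> {}"
      using that by (auto simp: L_def R_def C_def)
    moreover have "finite R" "finite C"
      by (simp_all add: R_def C_def)
    ultimately have "card R \<noteq> 0"
      using bal n by (metis card_0_eq mult_0 mult_eq_0_iff not_gr_zero)
    moreover have "n div gcd n m dvd card R"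
    proof -
      have "n dvd card R * m"
        by (simp add: bal)
      then have "(n div gcd n m) * gcd n m dvd (card R * (m div gcd n m)) * gcd n m"
        by (simp add: mult.assoc)
      then have "n div gcd n m dvd card R * (m div gcd n m)"
        using n by (subst (asm) dvd_times_right_cancel_iff) simp_all
      moreover have "coprime (n div gcd n m) (m div gcd n m)"
        using n by (intro div_gcd_coprime) simp
      ultimately show ?thesis
        by (simp add: coprime_dvd_mult_left_iff)
    qed
    ultimately have "n div gcd n m \<le> card R"
      by (intro dvd_imp_le) simp_all
    then show ?thesis
      by (simp only: R_def)
  qed
  have "card L * (n div gcd n m) \<le> (\<Sum>l\<in>L. card {i \<in> {..<n}. rl i = l})"
    using sum_mono[OF fibre, of L "\<lambda>l. l"] by simp
  also have "\<dots> = (\<Sum>l\<in>L. \<Sum>i\<in>{i \<in> {..<n}. rl i = l}. 1)"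
    by simp
  also have "\<dots> = (\<Sum>i<n. 1)"
    by (rule sum.group) (auto simp: L_def)
  also have "\<dots> = gcd n m * (n div gcd n m)"
    by simp
  finally have "card L * (n div gcd n m) \<le> gcd n m * (n div gcd n m)" .
  moreover have "n div gcd n m > 0"
    using n by (simp add: div_greater_zero_iff gcd_le1_nat)
  ultimately show ?thesis
    unfolding L_def by (simp only: mult_le_cancel2)
qed

text \<open>The support graph has \<open>n + m\<close> vertices; \<open>Inl\<close> marks the rows and \<open>Inr\<close> the columns.\<close>

lemma card_mat_supp_ge:
  assumes n: "n > 0" and A: "A \<in> doubly_stochastic_arrays n m"
  shows "n + m - gcd n m \<le> card (mat_supp A)"
proof -
  define V :: "(nat + nat) set" where "V = {..<n} <+> {..<m}"
  define E :: "((nat + nat) \<times> (nat + nat)) set" where "E = map_prod Inl Inr ` mat_supp A"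
  have "finite V" "finite E"
    by (simp_all add: V_def E_def finite_mat_supp)
  from edge_constant_labelling[OF this] obtain f :: "nat + nat \<Rightarrow> nat + nat"
    where f: "\<forall>(u, v)\<in>E. f u = f v" and card_f: "card V \<le> card (f ` V) + card E"
    by blast
  have "f (Inl i) = f (Inr j)" if "(i, j) \<in> mat_supp A" for i j
    using f that by (force simp: E_def)
  then have "card ((\<lambda>i. f (Inl i)) ` {..<n} \<union> (\<lambda>j. f (Inr j)) ` {..<m}) \<le> gcd n m"
    by (rule labels_le_gcd[OF n A])
  moreover have "f ` V = (\<lambda>i. f (Inl i)) ` {..<n} \<union> (\<lambda>j. f (Inr j)) ` {..<m}"
    by (simp add: V_def Plus_def image_Un image_image)
  moreover have "card V = n + m"
    by (simp add: V_def card_Plus)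
  moreover have "card E \<le> card (mat_supp A)"
    unfolding E_def by (rule card_image_le[OF finite_mat_supp])
  ultimately show ?thesis
    using card_f by simp
qed

section \<open>Upper bound: overlapping two subdivisions of an interval\<close>

definition overlap_array :: "nat \<Rightarrow> nat \<Rightarrow> real mat" where
  "overlap_array n m =
     mat n m (\<lambda>(i, j). real (card {t \<in> {..<n * m}. t div m = i \<and> t div n = j}))"

lemma card_div_fibre:
  fixes i n m :: nat
  assumes "i < n" and "m > 0"
  shows "card {t \<in> {..<n * m}. t div m = i} = m"
proof -
  have "Suc i * m \<le> n * m"
    using assms by (intro mult_le_mono1) simp
  then have "{t \<in> {..<n * m}. t div m = i} = {i * m..<Suc i * m}"
    using assms(2) by (auto simp: dividend_less_times_div mult.commute intro!: div_nat_eqI)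
  then show ?thesis by simp
qed

text \<open>Row \<open>i\<close> distributes the unit masses of its block over the columns, so its sum is the length
  of the block; likewise for columns.\<close>

lemma overlap_array_doubly_stochastic:
  assumes n: "n > 0" and m: "m > 0"
  shows "overlap_array n m \<in> doubly_stochastic_arrays n m"
proof -
  let ?I = "\<lambda>i j. {t \<in> {..<n * m}. t div m = i \<and> t div n = j}"
  have "(\<Sum>j<m. card (?I i j)) = m" if "i < n" for i
  proof -
    have "(\<Sum>j<m. card (?I i j)) =
        (\<Sum>j<m. \<Sum>t\<in>{t \<in> {t \<in> {..<n * m}. t div m = i}. t div n = j}. 1)"
      by (simp add: conj_ac)
    also have "\<dots> = (\<Sum>t\<in>{t \<in> {..<n * m}. t div m = i}. 1)"
      by (rule sum.group) (auto simp: less_mult_imp_div_less mult.commute)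
    also have "\<dots> = m"
      using card_div_fibre[OF that m] by simp
    finally show ?thesis .
  qed
  moreover have "(\<Sum>i<n. card (?I i j)) = n" if "j < m" for j
  proof -
    have "(\<Sum>i<n. card (?I i j)) =
        (\<Sum>i<n. \<Sum>t\<in>{t \<in> {t \<in> {..<n * m}. t div n = j}. t div m = i}. 1)"
      by (simp add: conj_ac)
    also have "\<dots> = (\<Sum>t\<in>{t \<in> {..<n * m}. t div n = j}. 1)"
      by (rule sum.group) (auto simp: less_mult_imp_div_less)
    also have "\<dots> = n"
      using card_div_fibre[OF that n] by (simp add: mult.commute)
    finally show ?thesis .
  qed
  ultimately show ?thesis
    by (simp add: doubly_stochastic_arrays_def overlap_array_def flip: of_nat_sum)
qed

lemma card_multiples_below:
  fixes d k :: nat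
  assumes "d > 0"
  shows "card {t \<in> {..<k * d}. d dvd t} = k"
proof -
  have "{t \<in> {..<k * d}. d dvd t} = (\<lambda>q. q * d) ` {..<k}"
    using assms by (auto elim!: dvdE simp: mult.commute)
  moreover have "inj_on (\<lambda>q. q * d) {..<k}"
    using assms by (auto intro: inj_onI)
  ultimately show ?thesis by (simp add: card_image)
qed

text \<open>The common multiples of \<open>n\<close> and \<open>m\<close> below \<open>n * m = gcd n m * lcm n m\<close> are counted twice;
  there are \<open>gcd n m\<close> of them.\<close>

lemma card_breakpoints:
  fixes n m :: nat
  assumes n: "n > 0" and m: "m > 0"
  shows "card {t \<in> {..<n * m}. m dvd t \<or> n dvd t} = n + m - gcd n m"
proof -
  let ?M = "\<lambda>d. {t \<in> {..<n * m}. d dvd t}"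
  have "card (?M m) + card (?M n) = card (?M m \<union> ?M n) + card (?M m \<inter> ?M n)"
    by (rule card_Un_Int) auto
  moreover have "?M m \<inter> ?M n = ?M (lcm n m)"
    by auto
  moreover have "card (?M m) = n"
    using card_multiples_below[OF m] .
  moreover have "card (?M n) = m"
    using card_multiples_below[OF n, of m] by (simp add: mult.commute)
  moreover have "card (?M (lcm n m)) = gcd n m"
    using card_multiples_below[of "lcm n m" "gcd n m"] n m
    by (simp add: lcm_pos_nat flip: prod_gcd_lcm_nat)
  moreover have "?M m \<union> ?M n = {t \<in> {..<n * m}. m dvd t \<or> n dvd t}"
    by auto
  ultimately show ?thesis by simp
qed

text \<open>A pair of overlapping blocks is determined by the first point of the overlap, which is the
  first point of one of the two blocks.\<close>

lemma card_mat_supp_overlap_array_le: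
  assumes n: "n > 0" and m: "m > 0"
  shows "card (mat_supp (overlap_array n m)) \<le> n + m - gcd n m"
proof -
  let ?T = "{t \<in> {..<n * m}. m dvd t \<or> n dvd t}"
  have "mat_supp (overlap_array n m) \<subseteq> (\<lambda>t. (t div m, t div n)) ` ?T"
  proof clarify
    fix i j
    assume "(i, j) \<in> mat_supp (overlap_array n m)"
    then have "card {t \<in> {..<n * m}. t div m = i \<and> t div n = j} \<noteq> 0"
      by (auto simp: mat_supp_def overlap_array_def)
    then obtain t where t: "t < n * m" "t div m = i" "t div n = j"
      by (auto simp: card_eq_0_iff)
    \<comment> \<open>The last breakpoint up to \<open>t\<close> lies in the same two blocks as \<open>t\<close>.\<close>
    define s where "s = max (m * (t div m)) (n * (t div n))"
    have "s \<le> t"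
      by (simp add: s_def)
    have "s div m = t div m"
    proof (rule antisym)
      show "s div m \<le> t div m" using \<open>s \<le> t\<close> by (rule div_le_mono)
      show "t div m \<le> s div m"
        using div_le_mono[of "m * (t div m)" s m] m by (simp add: s_def)
    qed
    moreover have "s div n = t div n"
    proof (rule antisym)
      show "s div n \<le> t div n" using \<open>s \<le> t\<close> by (rule div_le_mono)
      show "t div n \<le> s div n"
        using div_le_mono[of "n * (t div n)" s n] n by (simp add: s_def)
    qed
    moreover have "s \<in> ?T"
      using \<open>s \<le> t\<close> t(1) by (auto simp: s_def max_def)
    ultimately show "(i, j) \<in> (\<lambda>t. (t div m, t div n)) ` ?T"
      using t by (intro image_eqI[of _ _ s]) auto
  qed
  then have "card (mat_supp (overlap_array n m)) \<le> card ?T"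
    by (rule surj_card_le[rotated]) simp
  then show ?thesis
    by (simp only: card_breakpoints[OF n m])
qed

section \<open>The minimal support size\<close>

theorem theorem1p1:
  fixes n m :: nat
  assumes "n > 0" and "m > 0"
  shows "Min ((\<lambda>A. card (mat_supp A)) ` doubly_stochastic_arrays n m) = n + m - gcd n m"
proof (rule Min_eqI[OF finite_supp_sizes])
  show "n + m - gcd n m \<le> k"
    if "k \<in> (\<lambda>A. card (mat_supp A)) ` doubly_stochastic_arrays n m" for k
    using that card_mat_supp_ge[OF assms(1)] by blast
  have "card (mat_supp (overlap_array n m)) = n + m - gcd n m"
    using card_mat_supp_overlap_array_le[OF assms]
      card_mat_supp_ge[OF assms(1) overlap_array_doubly_stochastic[OF assms]]
    by (rule antisym)
  then show "n + m - gcd n m \<in> (\<lambda>A. card (mat_supp A)) ` doubly_stochastic_arrays n m"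
    using overlap_array_doubly_stochastic[OF assms] by (metis imageI)
qed

end
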